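(* For every integer $s\ge 0$ and every integer $r\ge 1$, the sequence $(A(n,r,s))_{n=1}^\infty$, where $$A(n,r,s)=\sum_{k=0}^n \binom{n}{k}^r\binom{n+k}{k}^s,$$ is realizable.
   Context: A sequence $a=(a(n))_{n=1}^\infty$ of non-negative integers is called realizable if one of the following two equivalent conditions holds: (1) there is a self-map $T:X\to X$ on a set $X$ such that $a(n)=\#\{x\in X: T^n(x)=x\}$ for all $n\ge 1$; (2) for all $n\ge 1$, $(\mu*a)(n)=\sum_{d\mid n}\mu(n/d)\,a(d)$ is a non-negative integer divisible by $n$, where $\mu$ is the classical Möbius function and $*$ is Dirichlet convolution. *)

theory Defs
  imports "HOL-Computational_Algebra.Computational_Algebra"
begin

definition moebius :: "nat \<Rightarrow> int" where
  "moebius n = (if squarefree n then (-1) ^ card (prime_factors n) else 0)"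

(* (moebius * a)(n), where * is Dirichlet convolution *)
definition moebius_conv :: "(nat \<Rightarrow> nat) \<Rightarrow> nat \<Rightarrow> int" where
  "moebius_conv a n = (\<Sum>d | d dvd n. moebius (n div d) * int (a d))"

(* Sequences are indexed by n >= 1; the value a 0 is irrelevant.  The definition is the
   arithmetic condition; the theorems realizable_self_map and realizable_iff_self_map below
   show that it agrees with the condition of being a sequence of periodic point counts. *)
definition realizable :: "(nat \<Rightarrow> nat) \<Rightarrow> bool" where
  "realizable a \<longleftrightarrow> (\<forall>n\<ge>1. moebius_conv a n \<ge> 0 \<and> int n dvd moebius_conv a n)"

definition binom_power_sum :: "nat \<Rightarrow> nat \<Rightarrow> nat \<Rightarrow> nat" where
  "binom_power_sum n r s = (\<Sum>k=0..n. (n choose k) ^ r * ((n + k) choose k) ^ s)"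

lemma moebius_1 [simp]: "moebius (Suc 0) = 1"
  by (simp add: moebius_def)

lemma moebius_prime_mult:
  assumes "prime p" "\<not> p dvd d" "d > 0"
  shows "moebius (p * d) = - moebius d"
proof -
  have cop: "coprime p d" using assms prime_imp_coprime by blast
  have sq: "squarefree (p * d) \<longleftrightarrow> squarefree d"
    using cop assms(1) squarefree_mult_coprime squarefree_multD(2) squarefree_prime by blast
  have "prime_factors (p * d) = insert p (prime_factors d)"
    using assms by (auto simp: prime_factors_product prime_prime_factors)
  moreover have "p \<notin> prime_factors d" using assms by auto
  ultimately show ?thesis by (simp add: moebius_def sq)
qed

lemma moebius_square:
  assumes "prime p" "p dvd d"
  shows "moebius (p * d) = 0"
proof -
  have "p\<^sup>2 dvd p * d" using assms(2) by (simp add: power2_eq_square)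
  then have "\<not> squarefree (p * d)" using assms(1) not_squarefreeI not_prime_unit by blast
  then show ?thesis by (simp add: moebius_def)
qed

lemma sum_moebius_divisors:
  assumes "n > 0"
  shows "(\<Sum>d | d dvd n. moebius d) = (if n = 1 then 1 else 0)"
proof (cases "n = 1")
  case True
  then show ?thesis by simp
next
  case False
  then obtain p where p: "prime p" "p dvd n" using prime_factor_nat by blast
  then have p0: "p > 0" using prime_gt_0_nat by blast
  have fin: "finite {d. d dvd n}" using assms by simp
  let ?N = "{d. d dvd n \<and> \<not> p dvd d}" and ?D = "{d. d dvd n \<and> p dvd d}"
  have img: "(\<lambda>d. p * d) ` ?N \<subseteq> ?D"
  proof clarsimp
    fix d assume d: "d dvd n" "\<not> p dvd d"
    then have "coprime p d" using p(1) prime_imp_coprime by blast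
    then show "p * d dvd n" using d(1) p(2) divides_mult by blast
  qed
  have "(\<Sum>d\<in>?D. moebius d) = (\<Sum>d\<in>(\<lambda>d. p * d) ` ?N. moebius d)"
  proof (rule sum.mono_neutral_right)
    show "finite ?D" by (rule finite_subset[OF _ fin]) auto
    show "\<forall>i\<in>?D - (\<lambda>d. p * d) ` ?N. moebius i = 0"
    proof
      fix i assume i: "i \<in> ?D - (\<lambda>d. p * d) ` ?N"
      then obtain e where e: "i = p * e" by auto
      with i have "e dvd n" using dvd_mult_right by blast
      with i e have "p dvd e" by auto
      then show "moebius i = 0" using e p(1) moebius_square by simp
    qed
  qed (rule img)
  also have "\<dots> = (\<Sum>d\<in>?N. moebius (p * d))"
    by (subst sum.reindex) (use p0 in \<open>auto simp: inj_on_def\<close>)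
  also have "\<dots> = (\<Sum>d\<in>?N. - moebius d)"
  proof (rule sum.cong[OF refl])
    fix d assume d: "d \<in> ?N"
    then have "d > 0" using assms dvd_pos_nat by blast
    then show "moebius (p * d) = - moebius d" using d p(1) moebius_prime_mult by simp
  qed
  finally have D: "(\<Sum>d\<in>?D. moebius d) = - (\<Sum>d\<in>?N. moebius d)"
    by (simp add: sum_negf)
  have U: "{d. d dvd n} = ?N \<union> ?D" by auto
  have "(\<Sum>d\<in>?N \<union> ?D. moebius d) = (\<Sum>d\<in>?N. moebius d) + (\<Sum>d\<in>?D. moebius d)"
    by (rule sum.union_disjoint) (auto intro: finite_subset[OF _ fin])
  then have "(\<Sum>d | d dvd n. moebius d) = 0" unfolding U[symmetric] D by simp
  then show ?thesis using False by simp
qed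

lemma bij_betw_between_divisors:
  fixes e n :: nat
  assumes "n > 0" "e dvd n"
  shows "bij_betw (\<lambda>d. d div e) {d. d dvd n \<and> e dvd d} {c. c dvd n div e}"
proof (rule bij_betw_byWitness[where f' = "\<lambda>c. e * c"])
  have e0: "e > 0" using assms dvd_pos_nat by blast
  show "(\<lambda>d. d div e) ` {d. d dvd n \<and> e dvd d} \<subseteq> {c. c dvd n div e}"
    using assms by (auto simp: div_dvd_div)
  show "(\<lambda>c. e * c) ` {c. c dvd n div e} \<subseteq> {d. d dvd n \<and> e dvd d}"
    using assms e0 by (auto simp: dvd_div_iff_mult mult.commute)
  show "\<forall>a\<in>{c. c dvd n div e}. e * a div e = a" using e0 by simp
qed auto

lemma bij_betw_codivisors:
  fixes n :: nat
  assumes "n > 0"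
  shows "bij_betw (\<lambda>d. n div d) {d. d dvd n} {d. d dvd n}"
proof (rule bij_betw_byWitness[where f' = "\<lambda>d. n div d"])
  have *: "n div (n div d) = d" if "d dvd n" for d
    using that assms by (auto elim!: dvdE)
  show "\<forall>d\<in>{d. d dvd n}. n div (n div d) = d" using * by blast
  show "\<forall>d\<in>{d. d dvd n}. n div (n div d) = d" using * by blast
qed (auto simp: div_dvd_iff_mult elim!: dvdE)

lemma div_div_cancel_nat:
  fixes e d n :: nat
  assumes "n > 0" "e dvd d" "d dvd n"
  shows "(n div e) div (d div e) = n div d"
  using assms by (auto elim!: dvdE)

lemma sum_moebius_between:
  fixes e n :: nat
  assumes "n > 0" "e dvd n"
  shows "(\<Sum>d | d dvd n \<and> e dvd d. moebius (d div e)) = (if e = n then 1 else 0)"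
    and "(\<Sum>d | d dvd n \<and> e dvd d. moebius (n div d)) = (if e = n then 1 else 0)"
proof -
  have n0: "n div e > 0" using assms by (auto elim!: dvdE)
  have iff: "n div e = 1 \<longleftrightarrow> e = n" using assms
    by (metis One_nat_def dvd_mult_div_cancel div_self mult.right_neutral not_gr_zero)
  have s: "(\<Sum>c | c dvd n div e. moebius c) = (if e = n then 1 else 0)"
    using sum_moebius_divisors[OF n0] by (simp only: iff)
  show "(\<Sum>d | d dvd n \<and> e dvd d. moebius (d div e)) = (if e = n then 1 else 0)"
    using sum.reindex_bij_betw[OF bij_betw_between_divisors[OF assms], of moebius] s by simp
  have "(\<Sum>d | d dvd n \<and> e dvd d. moebius (n div d))
      = (\<Sum>d | d dvd n \<and> e dvd d. moebius ((n div e) div (d div e)))"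
    by (rule sum.cong) (use assms in \<open>auto simp: div_div_cancel_nat\<close>)
  also have "\<dots> = (\<Sum>c | c dvd n div e. moebius ((n div e) div c))"
    by (rule sum.reindex_bij_betw[OF bij_betw_between_divisors[OF assms]])
  also have "\<dots> = (\<Sum>c | c dvd n div e. moebius c)"
    by (rule sum.reindex_bij_betw[OF bij_betw_codivisors[OF n0]])
  finally show "(\<Sum>d | d dvd n \<and> e dvd d. moebius (n div d)) = (if e = n then 1 else 0)"
    using s by simp
qed

lemma sum_divisors_swap:
  fixes f :: "nat \<Rightarrow> nat \<Rightarrow> int"
  assumes "n > 0"
  shows "(\<Sum>d | d dvd n. \<Sum>e | e dvd d. f d e) = (\<Sum>e | e dvd n. \<Sum>d | d dvd n \<and> e dvd d. f d e)"
proof -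
  have fin: "finite {d. d dvd n}" using assms by simp
  have "(\<Sum>d | d dvd n. \<Sum>e | e dvd d. f d e)
      = (\<Sum>d\<in>{d. d dvd n}. \<Sum>e\<in>{e\<in>{e. e dvd n}. e dvd d}. f d e)"
    by (intro sum.cong) (auto dest: dvd_trans)
  also have "\<dots> = (\<Sum>e\<in>{e. e dvd n}. \<Sum>d\<in>{d\<in>{d. d dvd n}. e dvd d}. f d e)"
    by (rule sum.swap_restrict[OF fin fin])
  finally show ?thesis by simp
qed

lemma moebius_conv_eqI:
  assumes "\<And>m. m > 0 \<Longrightarrow> a m = (\<Sum>d | d dvd m. b d)" "n > 0"
  shows "moebius_conv a n = int (b n)"
proof -
  have "moebius_conv a n = (\<Sum>d | d dvd n. \<Sum>e | e dvd d. moebius (n div d) * int (b e))"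
    unfolding moebius_conv_def
    by (rule sum.cong) (use assms dvd_pos_nat in \<open>auto simp: sum_distrib_left\<close>)
  also have "\<dots> = (\<Sum>e | e dvd n. \<Sum>d | d dvd n \<and> e dvd d. moebius (n div d) * int (b e))"
    by (rule sum_divisors_swap) fact
  also have "\<dots> = (\<Sum>e | e dvd n. (if e = n then 1 else 0) * int (b e))"
    by (rule sum.cong) (use assms(2) in \<open>auto simp: sum_moebius_between simp flip: sum_distrib_right\<close>)
  also have "\<dots> = (\<Sum>e | e dvd n. if e = n then int (b e) else 0)"
    by (rule sum.cong) auto
  also have "\<dots> = int (b n)" using assms(2) by (subst sum.delta) auto
  finally show ?thesis .
qed

lemma sum_moebius_conv:
  assumes "n > 0"
  shows "(\<Sum>d | d dvd n. moebius_conv a d) = int (a n)"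
proof -
  have "(\<Sum>d | d dvd n. moebius_conv a d)
      = (\<Sum>e | e dvd n. \<Sum>d | d dvd n \<and> e dvd d. moebius (d div e) * int (a e))"
    unfolding moebius_conv_def by (rule sum_divisors_swap) fact
  also have "\<dots> = (\<Sum>e | e dvd n. (if e = n then 1 else 0) * int (a e))"
    by (rule sum.cong) (use assms in \<open>auto simp: sum_moebius_between simp flip: sum_distrib_right\<close>)
  also have "\<dots> = (\<Sum>e | e dvd n. if e = n then int (a e) else 0)"
    by (rule sum.cong) auto
  also have "\<dots> = int (a n)" using assms by (subst sum.delta) auto
  finally show ?thesis .
qed

definition least_period :: "('a \<Rightarrow> 'a) \<Rightarrow> nat \<Rightarrow> 'a \<Rightarrow> bool" where
  "least_period T n x \<longleftrightarrow> n > 0 \<and> (\<forall>m. (T ^^ m) x = x \<longleftrightarrow> n dvd m)"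

lemma least_period_iff: "least_period T n x \<Longrightarrow> (T ^^ m) x = x \<longleftrightarrow> n dvd m"
  by (simp add: least_period_def)

lemma least_period_exists:
  assumes "(T ^^ n) x = x" "n > 0"
  shows "\<exists>d. least_period T d x"
proof -
  let ?P = "\<lambda>d. d > 0 \<and> (T ^^ d) x = x"
  define d where "d = (LEAST d. ?P d)"
  have d: "?P d" unfolding d_def by (rule LeastI[where P = ?P and k = n]) (use assms in simp)
  have min: "\<not> ?P m" if "m < d" for m using that not_less_Least unfolding d_def by blast
  have "(T ^^ m) x = x \<longleftrightarrow> d dvd m" for m
  proof -
    have "(T ^^ m) x = (T ^^ (m mod d)) x" using d funpow_mod_eq by metis
    moreover have "m mod d < d" using d by simp
    ultimately show ?thesis using min[of "m mod d"] by (auto simp: dvd_eq_mod_eq_0)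
  qed
  then show ?thesis using d unfolding least_period_def by blast
qed

lemma least_period_unique: "least_period T m x \<Longrightarrow> least_period T n x \<Longrightarrow> m = n"
  unfolding least_period_def by (meson dvd_antisym dvd_refl)

lemma funpow_eq_iff_cong:
  assumes "least_period T n x"
  shows "(T ^^ i) x = (T ^^ j) x \<longleftrightarrow> i mod n = j mod n"
proof -
  have per: "(T ^^ n) x = x" and n: "n > 0" using assms by (auto simp: least_period_def)
  have *: "i = j" if "(T ^^ i) x = (T ^^ j) x" "i \<le> j" "j < n" for i j
  proof -
    have "(T ^^ (n - j + i)) x = (T ^^ (n - j)) ((T ^^ i) x)" by (simp add: funpow_add)
    also have "\<dots> = (T ^^ (n - j + j)) x" using that(1) by (simp only: funpow_add o_apply)
    also have "\<dots> = x" using per that by simp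
    finally have "n dvd n - j + i" using assms by (simp add: least_period_def)
    then have "n \<le> n - j + i" using that(3) by (intro dvd_imp_le) auto
    with that(2,3) show "i = j" by simp
  qed
  have "(T ^^ i) x = (T ^^ (i mod n)) x" "(T ^^ j) x = (T ^^ (j mod n)) x"
    using per funpow_mod_eq by metis+
  moreover have "i mod n < n" "j mod n < n" using n by simp_all
  ultimately show ?thesis using *[of "i mod n" "j mod n"] *[of "j mod n" "i mod n"]
    by (cases "i mod n \<le> j mod n") auto
qed

lemma least_period_funpow:
  assumes "least_period T n x"
  shows "least_period T n ((T ^^ i) x)"
  unfolding least_period_def
proof (intro conjI allI)
  show "n > 0" using assms by (simp add: least_period_def)
  fix m
  have "(T ^^ m) ((T ^^ i) x) = (T ^^ i) x \<longleftrightarrow> (m + i) mod n = (0 + i) mod n"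
    using funpow_eq_iff_cong[OF assms, of "m + i" i] by (simp add: funpow_add)
  also have "\<dots> \<longleftrightarrow> n dvd m"
  proof -
    have "(m + i) mod n = (0 + i) mod n \<longleftrightarrow> int (m + i) mod int n = int i mod int n"
      by (metis add_0 of_nat_eq_iff zmod_int)
    also have "\<dots> \<longleftrightarrow> int n dvd int m" by (simp add: mod_eq_dvd_iff)
    finally show ?thesis by (simp only: int_dvd_int_iff)
  qed
  finally show "((T ^^ m) ((T ^^ i) x) = (T ^^ i) x) = (n dvd m)" .
qed

lemma funpow_mem: "T ` X \<subseteq> X \<Longrightarrow> x \<in> X \<Longrightarrow> (T ^^ i) x \<in> X"
  by (induction i) auto

lemma dvd_card_least_period:
  assumes "T ` X \<subseteq> X" "finite {x \<in> X. least_period T n x}"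
  shows "n dvd card {x \<in> X. least_period T n x}"
proof -
  let ?P = "{x \<in> X. least_period T n x}"
  define orb where "orb x = (\<lambda>i. (T ^^ i) x) ` {..<n}" for x
  have per: "(T ^^ i) x \<in> ?P" if "x \<in> ?P" for x i
    using that least_period_funpow[of T n x i] funpow_mem[OF assms(1), of x i] by simp
  have orb_UNIV: "orb x = range (\<lambda>i. (T ^^ i) x)" if "x \<in> ?P" for x
  proof -
    have "(T ^^ i) x \<in> orb x" for i
    proof -
      have n: "n > 0" and "(T ^^ i) x = (T ^^ (i mod n)) x"
        using that funpow_eq_iff_cong[of T n x i "i mod n"] by (auto simp: least_period_def)
      then show ?thesis unfolding orb_def by auto
    qed
    then show ?thesis unfolding orb_def by auto
  qed
  have orb_eq: "orb y = orb x" if x: "x \<in> ?P" and y: "y \<in> orb x" for x y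
  proof -
    obtain i where i: "i < n" "y = (T ^^ i) x" using y unfolding orb_def by auto
    have yP: "y \<in> ?P" using per x i by blast
    have "(T ^^ (n - i)) y = (T ^^ (n - i + i)) x" unfolding i(2) by (simp only: funpow_add o_apply)
    also have "\<dots> = x" using i(1) x by (simp add: least_period_def)
    finally have xy: "x = (T ^^ (n - i)) y" by simp
    have "(T ^^ k) x \<in> orb y" for k unfolding orb_UNIV[OF yP] 
      by (subst xy) (metis funpow_add o_apply rangeI)
    moreover have "(T ^^ k) y \<in> orb x" for k unfolding orb_UNIV[OF x] i(2)
      by (metis funpow_add o_apply rangeI)
    ultimately show ?thesis unfolding orb_UNIV[OF x] orb_UNIV[OF yP] by auto
  qed
  have self: "x \<in> orb x" if "x \<in> ?P" for x
    unfolding orb_UNIV[OF that] by (metis funpow_0 rangeI)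
  have U: "\<Union> (orb ` ?P) = ?P"
    using self per unfolding orb_def by blast
  have "n * card (orb ` ?P) = card (\<Union> (orb ` ?P))"
  proof (rule card_partition)
    show "finite (orb ` ?P)" using assms(2) by simp
    show "finite (\<Union> (orb ` ?P))" unfolding U by (rule assms(2))
  next
    fix c assume "c \<in> orb ` ?P"
    then obtain x where x: "x \<in> ?P" "c = orb x" by auto
    have "inj_on (\<lambda>i. (T ^^ i) x) {..<n}"
      using x(1) funpow_eq_iff_cong[of T n x] by (auto simp: inj_on_def)
    then show "card c = n" unfolding x(2) orb_def by (simp add: card_image)
  next
    fix c c' assume "c \<in> orb ` ?P" "c' \<in> orb ` ?P" "c \<noteq> c'"
    then show "c \<inter> c' = {}" using orb_eq by blast
  qed
  then show ?thesis unfolding U by (metis dvd_triv_left)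
qed

theorem realizable_self_map:
  fixes X :: "'a set" and T :: "'a \<Rightarrow> 'a"
  assumes "T ` X \<subseteq> X"
    and "\<And>n. n \<ge> 1 \<Longrightarrow> finite {x \<in> X. (T ^^ n) x = x} \<and> a n = card {x \<in> X. (T ^^ n) x = x}"
  shows "realizable a"
proof -
  define b where "b n = card {x \<in> X. least_period T n x}" for n
  have fin: "finite {x \<in> X. least_period T n x}" for n
  proof (cases "n > 0")
    case True
    then have "finite {x \<in> X. (T ^^ n) x = x}" using assms(2)[of n] by simp
    moreover have "{x \<in> X. least_period T n x} \<subseteq> {x \<in> X. (T ^^ n) x = x}"
      using least_period_iff[of T n _ n] by auto
    ultimately show ?thesis by (rule rev_finite_subset)
  qed (simp add: least_period_def)
  have a: "a m = (\<Sum>d | d dvd m. b d)" if m: "m > 0" for m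
  proof -
    have "{x \<in> X. (T ^^ m) x = x} = (\<Union>d\<in>{d. d dvd m}. {x \<in> X. least_period T d x})"
    proof (intro set_eqI iffI)
      fix x assume x: "x \<in> {x \<in> X. (T ^^ m) x = x}"
      then obtain d where d: "least_period T d x" using least_period_exists[OF _ m, of T x] by auto
      with x have "d dvd m" using least_period_iff[OF d, of m] by simp
      with x d show "x \<in> (\<Union>d\<in>{d. d dvd m}. {x \<in> X. least_period T d x})" by blast
    next
      fix x assume "x \<in> (\<Union>d\<in>{d. d dvd m}. {x \<in> X. least_period T d x})"
      then obtain d where d: "d dvd m" "x \<in> X" "least_period T d x" by blast
      with least_period_iff[OF d(3), of m] show "x \<in> {x \<in> X. (T ^^ m) x = x}" by simp
    qed
    moreover have "a m = card {x \<in> X. (T ^^ m) x = x}" using assms(2)[of m] that by simp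
    ultimately have "a m = card (\<Union>d\<in>{d. d dvd m}. {x \<in> X. least_period T d x})" by (simp only:)
    also have "\<dots> = (\<Sum>d | d dvd m. b d)" unfolding b_def
    proof (rule card_UN_disjoint)
      show "finite {d. d dvd m}" using that by simp
      show "\<forall>d\<in>{d. d dvd m}. finite {x \<in> X. least_period T d x}" using fin by blast
      show "\<forall>d\<in>{d. d dvd m}. \<forall>e\<in>{d. d dvd m}. d \<noteq> e \<longrightarrow>
          {x \<in> X. least_period T d x} \<inter> {x \<in> X. least_period T e x} = {}"
        using least_period_unique[of T] by auto
    qed
    finally show ?thesis .
  qed
  have conv: "moebius_conv a n = int (b n)" if "n > 0" for n
    by (rule moebius_conv_eqI[OF a that])
  have "n dvd b n" for n
    unfolding b_def by (rule dvd_card_least_period[OF assms(1) fin])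
  then show ?thesis unfolding realizable_def by (simp add: conv)
qed

lemma realizable_imp_self_map:
  assumes "realizable a"
  shows "\<exists>(X :: (nat \<times> nat \<times> nat) set) T. T ` X \<subseteq> X \<and>
    (\<forall>n\<ge>1. finite {x \<in> X. (T ^^ n) x = x} \<and> a n = card {x \<in> X. (T ^^ n) x = x})"
proof -
  define c where "c d = nat (moebius_conv a d) div d" for d
  have c: "int (d * c d) = moebius_conv a d" if "d > 0" for d
    using assms that unfolding realizable_def c_def
    by (metis One_nat_def Suc_leI dvd_mult_div_cancel int_dvd_int_iff int_nat_eq)
  define X where "X = {(d, j, i) |d j i. d > 0 \<and> j < c d \<and> i < d}"
  define T :: "nat \<times> nat \<times> nat \<Rightarrow> nat \<times> nat \<times> nat"
    where "T = (\<lambda>(d, j, i). (d, j, Suc i mod d))"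
  have pow: "(T ^^ n) (d, j, i) = (d, j, (i + n) mod d)" if "i < d" for n d j i
    by (induction n) (use that in \<open>auto simp: T_def mod_Suc_eq\<close>)
  have fixed: "(i + n) mod d = i \<longleftrightarrow> d dvd n" if "i < d" for n d i :: nat
  proof -
    have "(i + n) mod d = i \<longleftrightarrow> (i + n) mod d = i mod d" using that by simp
    also have "\<dots> \<longleftrightarrow> int (i + n) mod int d = int i mod int d"
      by (metis of_nat_eq_iff zmod_int)
    also have "\<dots> \<longleftrightarrow> int d dvd int n" by (simp add: mod_eq_dvd_iff)
    finally show ?thesis by (simp only: int_dvd_int_iff)
  qed
  have "T ` X \<subseteq> X" by (auto simp: X_def T_def)
  moreover have "finite {x \<in> X. (T ^^ n) x = x} \<and> a n = card {x \<in> X. (T ^^ n) x = x}"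
    if "n \<ge> 1" for n
  proof -
    have n: "n > 0" using that by simp
    have eq: "{x \<in> X. (T ^^ n) x = x} = Sigma {d. d dvd n} (\<lambda>d. {..<c d} \<times> {..<d})"
      using n by (auto simp: X_def pow fixed intro: Nat.gr0I)
    have "int (card {x \<in> X. (T ^^ n) x = x}) = (\<Sum>d | d dvd n. int (d * c d))"
      unfolding eq using n by (subst card_SigmaI) (auto simp: mult.commute)
    also have "\<dots> = (\<Sum>d | d dvd n. moebius_conv a d)"
      by (rule sum.cong) (use n c dvd_pos_nat in auto)
    also have "\<dots> = int (a n)" using n by (rule sum_moebius_conv)
    finally have "a n = card {x \<in> X. (T ^^ n) x = x}" by simp
    moreover have "finite {x \<in> X. (T ^^ n) x = x}" unfolding eq using n by auto
    ultimately show ?thesis by simp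
  qed
  ultimately show ?thesis by blast
qed

(* A countable X suffices, because only periodic points are counted. *)
theorem realizable_iff_self_map:
  "realizable a \<longleftrightarrow> (\<exists>(X :: (nat \<times> nat \<times> nat) set) T. T ` X \<subseteq> X \<and>
    (\<forall>n\<ge>1. finite {x \<in> X. (T ^^ n) x = x} \<and> a n = card {x \<in> X. (T ^^ n) x = x}))"
proof
  assume "realizable a"
  then show "\<exists>(X :: (nat \<times> nat \<times> nat) set) T. T ` X \<subseteq> X \<and>
    (\<forall>n\<ge>1. finite {x \<in> X. (T ^^ n) x = x} \<and> a n = card {x \<in> X. (T ^^ n) x = x})"
    by (rule realizable_imp_self_map)
next
  assume "\<exists>(X :: (nat \<times> nat \<times> nat) set) T. T ` X \<subseteq> X \<and>
    (\<forall>n\<ge>1. finite {x \<in> X. (T ^^ n) x = x} \<and> a n = card {x \<in> X. (T ^^ n) x = x})"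
  then obtain X :: "(nat \<times> nat \<times> nat) set" and T where T: "T ` X \<subseteq> X"
    and a: "\<forall>n\<ge>1. finite {x \<in> X. (T ^^ n) x = x} \<and> a n = card {x \<in> X. (T ^^ n) x = x}"
    by (elim exE conjE)
  show "realizable a" by (rule realizable_self_map[OF T]) (rule a[rule_format])
qed

end

theory Submission
  imports Defs
begin

text \<open>
  The sequence counts periodic points of a shift. Consider tuples of \<open>n\<close>-periodic sets
  \<open>K, K\<^sub>2, \<dots>, K\<^sub>r\<close> of natural numbers and \<open>n\<close>-periodic subsets \<open>L\<^sub>1, \<dots>, L\<^sub>s\<close> of the disjoint
  union of \<open>\<nat>\<close> with \<open>K\<close>, all having the same number \<open>k\<close> of elements per period. As that
  union has \<open>n + k\<close> elements per period, there are \<open>(n choose k)^r * ((n + k) choose k)^s\<close> such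
  tuples. Having the same number of elements per period does not depend on the chosen period,
  so the tuples with this property for some period form a shift-invariant set, whose points
  fixed by the \<open>n\<close>-th power of the shift number \<open>A(n,r,s)\<close>.
\<close>

definition shift :: "(nat \<Rightarrow> 'a) \<Rightarrow> nat \<Rightarrow> 'a" where
  "shift f i = f (Suc i)"

lemma shift_funpow: "(shift ^^ n) f i = f (n + i)"
  by (induction n arbitrary: i) (simp_all add: shift_def)

lemma shift_funpow_fixed_iff: "(shift ^^ n) f = f \<longleftrightarrow> (\<forall>i. f (n + i) = f i)"
  by (simp add: fun_eq_iff shift_funpow)

lemma periodic_mod:
  assumes "(shift ^^ n) f = f"
  shows "f (i mod n) = f i"
proof -
  have "f (j * n + i) = f i" for i j
  proof (induction j)
    case (Suc j)
    then show ?case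
      using assms by (simp add: shift_funpow_fixed_iff add.assoc)
  qed simp
  from this[of "i div n" "i mod n"] show ?thesis by simp
qed

text \<open>A family \<open>A\<close> encodes the set of pairs \<open>(i, c)\<close> with
  \<open>c \<in> A i\<close>. If \<open>A\<close> is \<open>n\<close>-periodic, this is its number
  of elements per period.\<close>

definition count_upto :: "nat \<Rightarrow> (nat \<Rightarrow> 'a set) \<Rightarrow> nat" where
  "count_upto n A = (\<Sum>i<n. card (A i))"

text \<open>The shifted window loses \<open>A 0\<close> and gains \<open>A n\<close>, which agree by
  periodicity.\<close>

lemma count_upto_shift:
  assumes "(shift ^^ n) A = A"
  shows "count_upto n (shift A) = count_upto n A"
proof -
  have "A n = A 0"
    using assms by (metis shift_funpow add_0_right)
  moreover have "card (A 0) + (\<Sum>i<n. card (A (Suc i))) = (\<Sum>i<n. card (A i)) + card (A n)"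
    using sum.lessThan_Suc_shift[of "\<lambda>i. card (A i)" n] by simp
  ultimately show ?thesis
    by (simp add: count_upto_def shift_def)
qed

lemma count_upto_mult:
  assumes "(shift ^^ n) A = A"
  shows "count_upto (m * n) A = m * count_upto n A"
proof -
  have "(\<Sum>i = j * n..<j * n + n. card (A i)) = count_upto n A" for j
  proof -
    have "(\<Sum>i = j * n..<j * n + n. card (A i)) = (\<Sum>i<n. card (A (i + j * n)))"
      using sum.shift_bounds_nat_ivl[of "\<lambda>i. card (A i)" 0 "j * n" n]
      by (simp add: add.commute lessThan_atLeast0)
    also have "\<dots> = (\<Sum>i<n. card (A i))"
      by (rule sum.cong) (use periodic_mod[OF assms] in \<open>metis mod_mult_self1\<close>)+
    finally show ?thesis
      by (simp add: count_upto_def)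
  qed
  then show ?thesis
    unfolding count_upto_def[of "m * n"] by (simp flip: sum.nat_group)
qed

text \<open>Over the common period \<open>m * n\<close> a family has \<open>m\<close> times its
  count over \<open>n\<close> and \<open>n\<close> times its count over \<open>m\<close>. Hence
  equality of counts does not depend on the period used.\<close>

lemma count_upto_eq_transfer:
  assumes "(shift ^^ m) A = A" "(shift ^^ n) A = A" "(shift ^^ m) B = B" "(shift ^^ n) B = B"
    and "m > 0" "count_upto m A = count_upto m B"
  shows "count_upto n A = count_upto n B"
proof -
  have "m * count_upto n A = m * count_upto n B"
    using assms by (metis count_upto_mult mult.commute)
  then show ?thesis
    using \<open>m > 0\<close> by simp
qed

definition periodic_subsets :: "nat \<Rightarrow> nat \<Rightarrow> (nat \<Rightarrow> 'a set) \<Rightarrow> (nat \<Rightarrow> 'a set) set" where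
  "periodic_subsets n k U = {A. A \<le> U \<and> (shift ^^ n) A = A \<and> count_upto n A = k}"

text \<open>A periodic family is determined by one period, and any subset of one period of
  \<open>U\<close> extends by repetition, that is, by reading indices modulo
  \<open>n\<close>.\<close>

lemma bij_betw_periodic_subsets:
  assumes "n > 0" "(shift ^^ n) U = U" "\<And>i. finite (U i)"
  shows "bij_betw (\<lambda>A. Sigma {..<n} A) (periodic_subsets n k U)
    {D. D \<subseteq> Sigma {..<n} U \<and> card D = k}"
proof (rule bij_betw_byWitness[where f' = "\<lambda>D i. {c. (i mod n, c) \<in> D}"])
  show "\<forall>A\<in>periodic_subsets n k U. (\<lambda>i. {c. (i mod n, c) \<in> Sigma {..<n} A}) = A"
    using assms(1) by (auto simp: periodic_subsets_def periodic_mod)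
  show "\<forall>D\<in>{D. D \<subseteq> Sigma {..<n} U \<and> card D = k}.
      (SIGMA i:{..<n}. {c. (i mod n, c) \<in> D}) = D"
    by auto
  have card: "card (Sigma {..<n} A) = count_upto n A" if "A \<le> U" for A
    unfolding count_upto_def
    by (rule card_SigmaI) (use that assms(3) in \<open>auto simp: le_fun_def intro: finite_subset\<close>)
  then show "Sigma {..<n} ` periodic_subsets n k U \<subseteq> {D. D \<subseteq> Sigma {..<n} U \<and> card D = k}"
    by (force simp: periodic_subsets_def le_fun_def)
  show "(\<lambda>D i. {c. (i mod n, c) \<in> D}) ` {D. D \<subseteq> Sigma {..<n} U \<and> card D = k}
      \<subseteq> periodic_subsets n k U"
  proof clarify
    fix D assume D: "D \<subseteq> Sigma {..<n} U" "k = card D"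
    let ?A = "\<lambda>i. {c. (i mod n, c) \<in> D}"
    have "?A \<le> U"
      using D(1) periodic_mod[OF assms(2)] by (fastforce simp: le_fun_def)
    moreover have "Sigma {..<n} ?A = D"
      using D(1) by auto
    ultimately show "?A \<in> periodic_subsets n (card D) U"
      using card[of ?A] by (simp add: periodic_subsets_def shift_funpow_fixed_iff)
  qed
qed

lemma
  assumes "n > 0" "(shift ^^ n) U = U" "\<And>i. finite (U i)"
  shows finite_periodic_subsets: "finite (periodic_subsets n k U)"
    and card_periodic_subsets: "card (periodic_subsets n k U) = count_upto n U choose k"
proof -
  have fin: "finite (Sigma {..<n} U)"
    using assms(3) by auto
  have "card (Sigma {..<n} U) = count_upto n U"
    using assms(3) by (simp add: count_upto_def)
  then show "card (periodic_subsets n k U) = count_upto n U choose k"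
    using bij_betw_same_card[OF bij_betw_periodic_subsets[OF assms]] n_subsets[OF fin] by metis
  have "finite {D. D \<subseteq> Sigma {..<n} U \<and> card D = k}"
    by (rule finite_subset[of _ "Pow (Sigma {..<n} U)"]) (use fin in auto)
  then show "finite (periodic_subsets n k U)"
    using bij_betw_finite[OF bij_betw_periodic_subsets[OF assms]] by metis
qed

lemma shift_periodic_subsets:
  assumes "A \<in> periodic_subsets n k U"
  shows "shift A \<in> periodic_subsets n k (shift U)"
proof -
  have "(shift ^^ n) (shift A) = shift ((shift ^^ n) A)"
    by (simp add: funpow_swap1)
  then show ?thesis
    using assms by (auto simp: periodic_subsets_def count_upto_shift le_fun_def shift_def)
qed

text \<open>Over each natural number lie two points: \<open>False\<close> represents the copy of \<open>\<nat>\<close>, and \<open>True\<close> the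
  copy of \<open>K\<close> in the disjoint union.\<close>

definition base :: "nat \<Rightarrow> bool set" where
  "base i = {False}"

definition extend :: "(nat \<Rightarrow> bool set) \<Rightarrow> nat \<Rightarrow> bool set" where
  "extend K i = insert False (Not ` K i)"

lemma shift_base [simp]: "shift base = base"
  by (simp add: fun_eq_iff shift_def base_def)

lemma shift_funpow_base [simp]: "(shift ^^ n) base = base"
  by (induction n) auto

lemma shift_extend: "shift (extend K) = extend (shift K)"
  by (simp add: fun_eq_iff shift_def extend_def)

lemma shift_funpow_extend: "(shift ^^ n) (extend K) = extend ((shift ^^ n) K)"
  by (induction n) (simp_all add: shift_extend)

lemma count_upto_base [simp]: "count_upto n base = n"
  by (simp add: count_upto_def base_def)

lemma count_upto_extend:
  assumes "K \<le> base"
  shows "count_upto n (extend K) = n + count_upto n K"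
proof -
  have "card (extend K i) = Suc (card (K i))" for i
  proof -
    \<comment> \<open>The image under \<open>Not\<close> then lies in \<open>{True}\<close>, so
      inserting \<open>False\<close> adds exactly one element.\<close>
    have "K i \<subseteq> {False}"
      using assms by (simp add: le_fun_def base_def)
    then have "False \<notin> Not ` K i"
      by auto
    then show ?thesis
      by (simp add: extend_def card_image inj_on_def)
  qed
  then show ?thesis
    by (simp add: count_upto_def sum_Suc)
qed

text \<open>One of the \<open>r = Suc q\<close> subsets of \<open>base\<close> is singled out as
  \<open>K\<close>, because the ambient set of the \<open>Ls\<close> depends on it.\<close>

definition configs :: "nat \<Rightarrow> nat \<Rightarrow> nat \<Rightarrow> nat \<Rightarrow>
    ((nat \<Rightarrow> bool set) \<times> (nat \<Rightarrow> bool set) list \<times> (nat \<Rightarrow> bool set) list) set" where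
  "configs q s n k = (SIGMA K : periodic_subsets n k base.
     {Ks. set Ks \<subseteq> periodic_subsets n k base \<and> length Ks = q} \<times>
     {Ls. set Ls \<subseteq> periodic_subsets n k (extend K) \<and> length Ls = s})"

lemma
  assumes "n > 0"
  shows finite_configs: "finite (configs q s n k)"
    and card_configs: "card (configs q s n k) = (n choose k) ^ Suc q * ((n + k) choose k) ^ s"
proof -
  have fin: "finite (periodic_subsets n k base)"
    and card: "card (periodic_subsets n k base) = n choose k"
    using finite_periodic_subsets[of n base k] card_periodic_subsets[of n base k] assms by simp_all
  have ext: "finite (periodic_subsets n k (extend K))"
      "card (periodic_subsets n k (extend K)) = (n + k) choose k"
    if "K \<in> periodic_subsets n k base" for K
    using that assms finite_periodic_subsets[of n "extend K" k]
      card_periodic_subsets[of n "extend K" k]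
    by (simp_all add: periodic_subsets_def shift_funpow_extend count_upto_extend)
  show "finite (configs q s n k)"
    unfolding configs_def by (auto intro!: finite_SigmaI finite_lists_length_eq fin ext)
  \<comment> \<open>The number of choices for \<open>Ks\<close> and \<open>Ls\<close> is the same
    for every \<open>K\<close>, so the sum over \<open>K\<close> contributes the last factor
    \<open>n choose k\<close>.\<close>
  have "card (configs q s n k) =
      (\<Sum>K\<in>periodic_subsets n k base. (n choose k) ^ q * ((n + k) choose k) ^ s)"
    unfolding configs_def
    by (subst card_SigmaI)
      (auto simp: card_cartesian_product card_lists_length_eq fin card ext
        intro!: finite_lists_length_eq)
  then show "card (configs q s n k) = (n choose k) ^ Suc q * ((n + k) choose k) ^ s"
    by (simp add: card)
qed

definition config_shift :: "(nat \<Rightarrow> 'a) \<times> (nat \<Rightarrow> 'a) list \<times> (nat \<Rightarrow> 'a) list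
    \<Rightarrow> (nat \<Rightarrow> 'a) \<times> (nat \<Rightarrow> 'a) list \<times> (nat \<Rightarrow> 'a) list" where
  "config_shift = (\<lambda>(K, Ks, Ls). (shift K, map shift Ks, map shift Ls))"

lemma config_shift_funpow:
  "(config_shift ^^ n) (K, Ks, Ls) =
    ((shift ^^ n) K, map (shift ^^ n) Ks, map (shift ^^ n) Ls)"
  by (induction n) (simp_all add: config_shift_def)

text \<open>\<open>base\<close> is shift-invariant and \<open>extend\<close> commutes with the
  shift, so the ambient sets move along with the tuple.\<close>

lemma config_shift_mem: "x \<in> configs q s n k \<Longrightarrow> config_shift x \<in> configs q s n k"
  using shift_periodic_subsets[of _ n k base] shift_periodic_subsets[of _ n k "extend (fst x)"]
  by (fastforce simp: configs_def config_shift_def shift_extend)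

lemma configs_fixed: "x \<in> configs q s n k \<Longrightarrow> (config_shift ^^ n) x = x"
  by (auto simp: configs_def config_shift_funpow periodic_subsets_def intro!: map_idI)

lemma configs_change_period:
  assumes x: "(K, Ks, Ls) \<in> configs q s m j" and "m > 0"
    and fixed: "(config_shift ^^ n) (K, Ks, Ls) = (K, Ks, Ls)"
  shows "(K, Ks, Ls) \<in> configs q s n (count_upto n K)"
proof -
  have K: "K \<in> periodic_subsets m j base"
    using x by (simp add: configs_def)
  have fixK: "(shift ^^ n) K = K"
    using fixed by (simp add: config_shift_funpow)
  have fixKsLs: "(shift ^^ n) A = A" if "A \<in> set Ks \<union> set Ls" for A
    using fixed that map_eq_conv[of "shift ^^ n" Ks id] map_eq_conv[of "shift ^^ n" Ls id]
    by (auto simp: config_shift_funpow)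
  \<comment> \<open>Each component has the same count as \<open>K\<close> over \<open>m\<close>,
    hence also over \<open>n\<close>. The ambient \<open>U\<close> is left general to cover both
    \<open>base\<close> and \<open>extend K\<close>.\<close>
  have "A \<in> periodic_subsets n (count_upto n K) U"
    if "A \<in> periodic_subsets m j U" "(shift ^^ n) A = A" for A U
    using that K fixK count_upto_eq_transfer[of m A n K] \<open>m > 0\<close>
    by (simp add: periodic_subsets_def)
  then show ?thesis
    using x K fixK fixKsLs by (auto simp: configs_def)
qed

theorem theorem13:
  fixes r s :: nat
  assumes "r \<ge> 1"
  shows "realizable (\<lambda>n. binom_power_sum n r s)"
proof -
  obtain q where r: "r = Suc q"
    using assms by (cases r) auto
  \<comment> \<open>Period 0 is excluded: it would admit all families within the ambient sets, with
    count 0.\<close>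
  define X where "X = (\<Union>n\<in>{0<..}. \<Union>k. configs q s n k)"
  show ?thesis
  proof (rule realizable_self_map[where X = X and T = config_shift], goal_cases)
    case 1
    show ?case
      using config_shift_mem by (fastforce simp: X_def)
  next
    case (2 n)
    then have n: "n > 0" by simp
    \<comment> \<open>The factor \<open>n choose k\<close> vanishes, and a finite set of cardinality
      0 is empty.\<close>
    have large: "configs q s n k = {}" if "k > n" for k
      using card_configs[OF n, of q s k] finite_configs[OF n, of q s k] that
      by (simp add: binomial_eq_0)
    have eq: "{x \<in> X. (config_shift ^^ n) x = x} = (\<Union>k\<in>{0..n}. configs q s n k)"
    proof (intro set_eqI iffI)
      fix x assume x: "x \<in> {x \<in> X. (config_shift ^^ n) x = x}"
      then obtain k where k: "x \<in> configs q s n k"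
        using configs_change_period by (cases x) (fastforce simp: X_def)
      then have "k \<le> n"
        using large[of k] by fastforce
      with k show "x \<in> (\<Union>k\<in>{0..n}. configs q s n k)" by auto
    next
      fix x assume "x \<in> (\<Union>k\<in>{0..n}. configs q s n k)"
      then show "x \<in> {x \<in> X. (config_shift ^^ n) x = x}"
        using n configs_fixed[of x] by (auto simp: X_def)
    qed
    \<comment> \<open>The component \<open>K\<close> determines \<open>k\<close> as
      \<open>count_upto n K\<close>.\<close>
    have "configs q s n k \<inter> configs q s n k' = {}" if "k \<noteq> k'" for k k'
      using that by (auto simp: configs_def periodic_subsets_def)
    then have "card (\<Union>k\<in>{0..n}. configs q s n k) = binom_power_sum n r s"
      by (subst card_UN_disjoint)
        (auto simp: finite_configs[OF n] card_configs[OF n] binom_power_sum_def r)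
    then show ?case
      unfolding eq using finite_configs[OF n] by auto
  qed
qed

end
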